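(* Let $G=(V,E)$ be a finite connected graph with edges $E=\{e_1,\dots,e_n\}$, let $\kappa^*=(\kappa_1^*,\dots,\kappa_n^* )\in\mathbb{R}^n$ be a prescribed curvature vector, and let $\bm\omega_0=(\omega_{1,0},\dots,\omega_{n,0})\in\mathbb{R}^n_{>0}$ be a positive initial value. Then the system $$\frac{d}{dt}\omega_i=-(\kappa_i(\bm\omega)-\kappa_i^* )\,\omega_i,\quad i=1,\dots,n,\qquad \bm\omega(0)=\bm\omega_0,$$ admits a unique positive solution on $[0,\infty)$.
   Context: Graphs are finite, connected, undirected and simple. A weight is a vector $\bm\omega=(\omega_1,\dots,\omega_n)\in\mathbb{R}^n_{>0}$ with $\omega_i=\omega(e_i)$; $\omega_{xy}=\omega_{yx}$ is the weight of edge $(x,y)$. Write $y\sim x$ if $(x,y)\in E$, and $m(x)=\sum_{y\sim x}\omega_{xy}$. The distance $d(u,v)$ is the combinatorial one (number of edges of a shortest path) and does not depend on the weights or on time. Lin-Lu-Yau curvature: for $x\in V$ and $\alpha\in(0,1)$ let $m_x^\alpha$ be the probability measure with $m_x^\alpha(x)=\alpha$, $m_x^\alpha(y)=(1-\alpha)\omega_{xy}/m(x)$ for $y\sim x$, and $0$ otherwise. For $x\ne y$, $\kappa(x,y)=\lim_{\alpha\to1^-}\frac{1}{1-\alpha}\left(1-\frac{W(m_x^\alpha,m_y^\alpha)}{d(x,y)}\right)$, where $W$ is the $1$-Wasserstein distance with respect to $d$. Equivalently (Münch–Wojciechowski), $\kappa(x,y)=\inf_f \frac{\Delta f(x)-\Delta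 f(y)}{d(x,y)}$ over functions $f:V\to\mathbb{R}$ that are $1$-Lipschitz for $d$ with $f(y)-f(x)=d(x,y)$, where $\Delta f(x)=\frac1{m(x)}\sum_{z\sim x}\omega_{xz}(f(z)-f(x))$. For an edge $e_i=(x,y)$ put $\kappa_i(\bm\omega)=\kappa(x,y)$. *)

theory Defs
  imports Complex_Main
begin

text \<open>
  A finite simple graph is a vertex set \<open>V\<close> with a set \<open>E\<close> of two-element subsets of \<open>V\<close>.
  A weight (likewise a prescribed curvature vector) is a function on the unordered edges
  \<open>{x, y} \<in> E\<close>, i.e. its coordinates are indexed by the edges themselves, and only its
  values on \<open>E\<close> matter.
\<close>

definition adj :: "'a set set \<Rightarrow> ('a \<times> 'a) set" where
  "adj E = {(x, y). {x, y} \<in> E}"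

definition finite_connected_graph :: "'a set \<Rightarrow> 'a set set \<Rightarrow> bool" where
  "finite_connected_graph V E \<longleftrightarrow>
     finite V \<and> V \<noteq> {} \<and> (\<forall>e\<in>E. e \<subseteq> V \<and> card e = 2) \<and>
     (\<forall>x\<in>V. \<forall>y\<in>V. (x, y) \<in> (adj E)\<^sup>*)"

text \<open>\<open>(x, y) \<in> adj E ^^ n\<close> says that there is a walk with \<open>n\<close> edges from \<open>x\<close> to \<open>y\<close>.\<close>

definition graph_dist :: "'a set set \<Rightarrow> 'a \<Rightarrow> 'a \<Rightarrow> nat" where
  "graph_dist E x y = (LEAST n. (x, y) \<in> adj E ^^ n)"

definition vertex_weight :: "'a set set \<Rightarrow> ('a set \<Rightarrow> real) \<Rightarrow> 'a \<Rightarrow> real" where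
  "vertex_weight E \<omega> x = (\<Sum>y | {x, y} \<in> E. \<omega> {x, y})"

text \<open>The probability measure \<open>m\<^sub>x\<^sup>\<alpha>\<close>, given by its mass function.\<close>

definition lazy_walk :: "'a set set \<Rightarrow> ('a set \<Rightarrow> real) \<Rightarrow> real \<Rightarrow> 'a \<Rightarrow> 'a \<Rightarrow> real" where
  "lazy_walk E \<omega> \<alpha> x y =
     (if y = x then \<alpha>
      else if {x, y} \<in> E then (1 - \<alpha>) * \<omega> {x, y} / vertex_weight E \<omega> x
      else 0)"

definition couplings :: "'a set \<Rightarrow> ('a \<Rightarrow> real) \<Rightarrow> ('a \<Rightarrow> real) \<Rightarrow> ('a \<Rightarrow> 'a \<Rightarrow> real) set" where
  "couplings V \<mu> \<nu> =
     {\<pi>. (\<forall>u\<in>V. \<forall>v\<in>V. 0 \<le> \<pi> u v) \<and>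
         (\<forall>u\<in>V. (\<Sum>v\<in>V. \<pi> u v) = \<mu> u) \<and>
         (\<forall>v\<in>V. (\<Sum>u\<in>V. \<pi> u v) = \<nu> v)}"

definition wasserstein :: "'a set \<Rightarrow> 'a set set \<Rightarrow> ('a \<Rightarrow> real) \<Rightarrow> ('a \<Rightarrow> real) \<Rightarrow> real" where
  "wasserstein V E \<mu> \<nu> =
     (INF \<pi> \<in> couplings V \<mu> \<nu>. \<Sum>u\<in>V. \<Sum>v\<in>V. real (graph_dist E u v) * \<pi> u v)"

text \<open>The Lin-Lu-Yau curvature \<open>\<kappa>(x, y)\<close> for the weight \<open>\<omega>\<close>, meant for distinct \<open>x, y \<in> V\<close>.\<close>

definition lly_curvature :: "'a set \<Rightarrow> 'a set set \<Rightarrow> ('a set \<Rightarrow> real) \<Rightarrow> 'a \<Rightarrow> 'a \<Rightarrow> real" where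
  "lly_curvature V E \<omega> x y =
     Lim (at_left 1) (\<lambda>\<alpha>. 1 / (1 - \<alpha>) *
       (1 - wasserstein V E (lazy_walk E \<omega> \<alpha> x) (lazy_walk E \<omega> \<alpha> y) / real (graph_dist E x y)))"

text \<open>
  Positive solutions on \<open>[0, \<infinity>)\<close> of the initial value problem; the derivative at \<open>t = 0\<close> is
  one-sided. The curvature of an edge is that of its endpoints, in either order.
\<close>

definition positive_flow_solution ::
  "'a set \<Rightarrow> 'a set set \<Rightarrow> ('a set \<Rightarrow> real) \<Rightarrow> ('a set \<Rightarrow> real) \<Rightarrow> (real \<Rightarrow> 'a set \<Rightarrow> real) \<Rightarrow> bool" where
  "positive_flow_solution V E \<kappa>' \<omega>0 \<omega> \<longleftrightarrow>
     (\<forall>t\<ge>0. \<forall>e\<in>E. \<omega> t e > 0) \<and>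
     (\<forall>e\<in>E. \<omega> 0 e = \<omega>0 e) \<and>
     (\<forall>t\<ge>0. \<forall>x y. {x, y} \<in> E \<longrightarrow>
        ((\<lambda>s. \<omega> s {x, y}) has_real_derivative
           - (lly_curvature V E (\<omega> t) x y - \<kappa>' {x, y}) * \<omega> t {x, y}) (at t within {0..}))"

end

theory Submission
  imports Defs "HOL-Probability.Discrete_Topology"
begin

text \<open>
  In the coordinates \<open>u = ln \<omega>\<close> the flow reads \<open>u' = \<kappa>' - \<kappa> (exp u)\<close>, and the right-hand side turns out
  to be globally Lipschitz. Hence solutions exist for all times and are unique, and
  \<open>\<omega> = exp u\<close> is automatically positive.

  The Lipschitz bound uses only the convexity of the Wasserstein distance in the pair of measures.
  For an edge \<open>x y\<close> consider the quotient \<open>(1 - W) / (1 - \<alpha>)\<close> whose limit is the curvature, for arbitrary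
  probability distributions on the neighbours of \<open>x\<close> and of \<open>y\<close>. It lies in \<open>[- 2, 2]\<close>
  (\<open>curvature_quotient_ge\<close>, \<open>curvature_quotient_le\<close>). Convexity gives two more facts. A lazier walk is a
  mixture of a less lazy one with the point mass, so the quotient increases with \<open>\<alpha>\<close>
  (\<open>curvature_quotient_mono\<close>) and the limit exists. And replacing a fraction \<open>1 - c\<close> of the
  step distributions lowers the quotient by at most \<open>4 (1 - c)\<close> (\<open>curvature_quotient_mix\<close>).

  If the logarithms of two weights differ by at most \<open>\<epsilon>\<close>, then their transition probabilities agree up
  to a factor \<open>exp (2 \<epsilon>)\<close>, so the new step distribution contains the fraction \<open>exp (- 2 \<epsilon>)\<close>
  of the old one (\<open>step_prob_mix\<close>). Therefore the curvature changes by at most \<open>8 \<epsilon>\<close>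
  (\<open>lly_curvature_log_lipschitz\<close>).

  For the differential equation, a globally Lipschitz field on a Banach space has global solutions by
  Banach's fixed point theorem in an exponentially weighted norm (\<open>lipschitz_ODE_solution_exists\<close>), and
  finite systems of real equations are a special case (\<open>lipschitz_system_solution_exists\<close>). Uniqueness for
  such systems is Gronwall's argument (\<open>lipschitz_system_solution_unique\<close>).
\<close>

section \<open>Ordinary differential equations with globally Lipschitz right-hand side\<close>


text \<open>
  The gain \<open>1 / K\<close>, as small as desired for a steep exponential weight, is what makes the Picard
  operator a contraction on an interval of any length.
\<close>

lemma norm_integral_exp_bound:
  fixes f :: "real \<Rightarrow> 'b::banach"
  assumes "continuous_on {0..t} f" and "K > 0" and "C \<ge> 0" and "t \<ge> 0"
    and "\<And>s. s \<in> {0..t} \<Longrightarrow> norm (f s) \<le> C * exp (K * s)"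
  shows "norm (integral {0..t} f) \<le> C / K * exp (K * t)"
proof -
  have int: "((\<lambda>s. C * exp (K * s)) has_integral (C / K * exp (K * t) - C / K * exp (K * 0))) {0..t}"
    using assms by (intro fundamental_theorem_of_calculus)
      (auto intro!: derivative_eq_intros simp flip: has_real_derivative_iff_has_vector_derivative)
  have "norm (integral {0..t} f) \<le> integral {0..t} (\<lambda>s. C * exp (K * s))"
    using assms int by (intro integral_norm_bound_integral integrable_continuous_real) (auto intro!: continuous_intros)
  also have "\<dots> = C / K * exp (K * t) - C / K"
    using integral_unique[OF int] by simp
  also have "\<dots> \<le> C / K * exp (K * t)"
    using assms by simp
  finally show ?thesis .
qed

lemma integral_has_vector_derivative_half_line:
  fixes f :: "real \<Rightarrow> 'b::banach"
  assumes "continuous_on {0..} f" "t \<ge> 0"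
  shows "((\<lambda>t. integral {0..t} f) has_vector_derivative f t) (at t within {0..})"
proof -
  have "((\<lambda>t. integral {0..t} f) has_vector_derivative f t) (at t within {0..t + 1})"
    using assms by (intro integral_has_vector_derivative continuous_on_subset[OF assms(1)]) auto
  moreover have "at t within {0..t + 1} = at t within {0..}"
    using assms(2) by (intro at_within_nhd[of t "{..<t + 1}"]) auto
  ultimately show ?thesis by simp
qed

text \<open>
  Picard iteration on the whole half-line at once. The unknown is the bounded curve
  \<open>g t = exp (- K t) (u t - a)\<close>; in the sup norm of \<open>g\<close>, integration gains a factor \<open>1 / K\<close>, so
  \<open>K > 2 L\<close> turns the integral equation into a contraction with constant \<open>1 / 2\<close>.
\<close>

theorem lipschitz_ODE_solution_exists:
  fixes F :: "'b::banach \<Rightarrow> 'b"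
  assumes lip: "\<And>a b. norm (F a - F b) \<le> L * norm (a - b)"
  shows "\<exists>u. u 0 = a \<and> (\<forall>t\<ge>0. (u has_vector_derivative F (u t)) (at t within {0..}))"
proof -
  \<comment> \<open>The maximum covers a negative \<open>L\<close>, possible in the zero space; the summand \<open>1\<close> keeps \<open>K\<close> positive.\<close>
  define M where "M = max L 0"
  define K where "K = 2 * M + 1"
  have K: "K > 0" "M \<ge> 0" and M_lip: "norm (F p - F q) \<le> M * norm (p - q)" for p q
    using lip[of p q] mult_right_mono[of L M "norm (p - q)"] by (auto simp: K_def M_def)
  have F_cont: "continuous_on S F" for S
  proof -
    have "M-lipschitz_on S F"
      using M_lip K by (auto simp: lipschitz_on_def dist_norm)
    then show ?thesis
      by (rule lipschitz_on_continuous_on)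
  qed
  define curve :: "(real \<Rightarrow>\<^sub>C 'b) \<Rightarrow> real \<Rightarrow> 'b" where "curve g t = a + exp (K * t) *\<^sub>R g t" for g t
  define J where "J g t = integral {0..t} (\<lambda>s. F (curve g s))" for g t
  have cont: "continuous_on S (\<lambda>s. F (curve g s))" for S g
    unfolding curve_def by (intro continuous_on_compose2[OF F_cont] continuous_intros) auto
  have J_deriv: "(J g has_vector_derivative F (curve g t)) (at t within {0..})" if "t \<ge> 0" for g t
    unfolding J_def using integral_has_vector_derivative_half_line[OF cont that] .
  have J_cont: "continuous_on {0..} (J g)" for g
    using J_deriv by (auto intro!: has_vector_derivative_continuous simp: continuous_on_eq_continuous_within)
  define C where "C g = norm (F a) + M * norm g" for g :: "real \<Rightarrow>\<^sub>C 'b"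
  have F_curve: "norm (F (curve g s)) \<le> C g * exp (K * s)" if "s \<ge> 0" for g s
  proof -
    have "norm (F (curve g s)) \<le> norm (F a) + norm (F (curve g s) - F a)"
      by (metis norm_triangle_sub)
    also have "\<dots> \<le> norm (F a) * exp (K * s) + M * norm (curve g s - a)"
      using that K M_lip by (intro add_mono) (auto simp: mult_le_cancel_left1)
    also have "\<dots> \<le> norm (F a) * exp (K * s) + M * (exp (K * s) * norm g)"
      using K by (intro add_left_mono mult_left_mono) (auto simp: curve_def norm_bounded)
    finally show ?thesis by (simp add: C_def algebra_simps)
  qed
  \<comment> \<open>Bounded continuous functions live on all of the real line; negative times are frozen at \<open>0\<close>.\<close>
  define T where "T g t = exp (- (K * max 0 t)) *\<^sub>R J g (max 0 t)" for g t
  have T_bcontfun: "T g \<in> bcontfun" for g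
  proof (rule bcontfun_normI)
    show "continuous_on UNIV (T g)"
      unfolding T_def by (intro continuous_intros continuous_on_compose2[OF J_cont]) auto
    fix t
    have "norm (J g (max 0 t)) \<le> C g / K * exp (K * max 0 t)"
      unfolding J_def using K cont F_curve by (intro norm_integral_exp_bound) (auto simp: C_def)
    then show "norm (T g t) \<le> C g / K"
      by (simp add: T_def exp_minus field_simps)
  qed
  have contraction: "dist (Bcontfun (T g)) (Bcontfun (T h)) \<le> 1 / 2 * dist g h" for g h
  proof (rule dist_bound)
    fix t :: real
    let ?t = "max 0 t :: real"
    have bound: "norm (F (curve g s) - F (curve h s)) \<le> M * dist g h * exp (K * s)" for s
    proof -
      have "curve g s - curve h s = exp (K * s) *\<^sub>R (g s - h s)"
        by (simp add: curve_def scaleR_diff_right)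
      then have "norm (curve g s - curve h s) \<le> dist g h * exp (K * s)"
        using dist_bounded[of g s h] by (simp add: dist_norm)
      from mult_left_mono[OF this K(2)] show ?thesis
        using M_lip[of "curve g s" "curve h s"] by (simp add: mult_ac)
    qed
    have "J g ?t - J h ?t = integral {0..?t} (\<lambda>s. F (curve g s) - F (curve h s))"
      unfolding J_def by (intro integral_diff[symmetric] integrable_continuous_real cont)
    also have "norm \<dots> \<le> M * dist g h / K * exp (K * ?t)"
      using K bound by (intro norm_integral_exp_bound continuous_on_diff cont) auto
    finally have J_diff: "norm (J g ?t - J h ?t) \<le> M * dist g h / K * exp (K * ?t)" .
    have "norm (T g t - T h t) = exp (- (K * ?t)) * norm (J g ?t - J h ?t)"
      unfolding T_def scaleR_diff_right[symmetric] by simp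
    also have "\<dots> \<le> exp (- (K * ?t)) * (M * dist g h / K * exp (K * ?t))"
      using J_diff by (intro mult_left_mono) auto
    also have "\<dots> = M * dist g h / K"
      by (simp add: exp_minus)
    finally have "norm (T g t - T h t) \<le> M * dist g h / K" .
    also have "M * dist g h / K = (M / K) * dist g h" by simp
    also have "\<dots> \<le> 1 / 2 * dist g h"
      using K by (intro mult_right_mono) (auto simp: K_def field_simps)
    finally show "dist (Bcontfun (T g) t) (Bcontfun (T h) t) \<le> 1 / 2 * dist g h"
      by (simp add: Bcontfun_inverse T_bcontfun dist_norm)
  qed
  obtain g where g: "Bcontfun (T g) = g"
    using banach_fix_type[of "1 / 2" "\<lambda>g. Bcontfun (T g)"] contraction by auto
  define u where "u t = a + J g t" for t
  have u_curve: "u t = curve g t" if "t \<ge> 0" for t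
  proof -
    have "g t = exp (- (K * t)) *\<^sub>R J g t"
      using g T_bcontfun[of g] that by (metis Bcontfun_inverse T_def max.absorb2)
    then show ?thesis
      by (simp add: u_def curve_def exp_minus)
  qed
  have "(u has_vector_derivative F (u t)) (at t within {0..})" if "t \<ge> 0" for t
    unfolding u_curve[OF that] unfolding u_def
    using J_deriv[OF that] by (auto intro!: derivative_eq_intros)
  moreover have "u 0 = a"
    by (simp add: u_def J_def)
  ultimately show ?thesis by blast
qed

text \<open>
  Families of reals indexed by a finite subset of an arbitrary type are made into elements of a Banach
  space by extending them by \<open>0\<close> to bounded functions on the type with its discrete topology.
\<close>

instance bcontfun :: (metric_space, banach) banach ..

theorem lipschitz_system_solution_exists:
  fixes F :: "('i \<Rightarrow> real) \<Rightarrow> 'i \<Rightarrow> real"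
  assumes fin: "finite I"
    and lip: "\<And>a b \<epsilon> i. i \<in> I \<Longrightarrow> \<epsilon> \<ge> 0 \<Longrightarrow> \<forall>j\<in>I. \<bar>a j - b j\<bar> \<le> \<epsilon> \<Longrightarrow> \<bar>F a i - F b i\<bar> \<le> L * \<epsilon>"
  shows "\<exists>u. \<forall>i\<in>I. u 0 i = a i \<and>
    (\<forall>t\<ge>0. ((\<lambda>s. u s i) has_real_derivative F (u t) i) (at t within {0..}))"
proof -
  define enc :: "('i \<Rightarrow> real) \<Rightarrow> 'i discrete \<Rightarrow>\<^sub>C real"
    where "enc x = Bcontfun (\<lambda>k. if of_discrete k \<in> I then x (of_discrete k) else 0)" for x
  define dec where "dec p i = apply_bcontfun p (discrete i)" for p :: "'i discrete \<Rightarrow>\<^sub>C real" and i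
  have enc_apply: "apply_bcontfun (enc x) k = (if of_discrete k \<in> I then x (of_discrete k) else 0)" for x k
  proof -
    have "range (\<lambda>k. if of_discrete k \<in> I then x (of_discrete k) else 0) \<subseteq> insert 0 (x ` I)"
      by auto
    then have "bounded (range (\<lambda>k. if of_discrete k \<in> I then x (of_discrete k) else 0))"
      using fin by (intro finite_imp_bounded) (auto intro: finite_subset)
    then have "(\<lambda>k. if of_discrete k \<in> I then x (of_discrete k) else 0) \<in> bcontfun"
      by (simp add: bcontfun_def continuous_on_open_vimage open_discrete)
    then show ?thesis
      by (simp add: enc_def Bcontfun_inverse)
  qed
  have dec_enc: "dec (enc x) i = x i" if "i \<in> I" for x i
    using that by (simp add: dec_def enc_apply discrete_inverse)
  define G where "G p = enc (F (dec p))" for p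
  have "norm (G p - G q) \<le> max L 0 * norm (p - q)" for p q
  proof -
    have "dist (G p) (G q) \<le> max L 0 * dist p q"
    proof (rule dist_bound)
      fix k
      show "dist (apply_bcontfun (G p) k) (apply_bcontfun (G q) k) \<le> max L 0 * dist p q"
      proof (cases "of_discrete k \<in> I")
        case True
        have "\<forall>j\<in>I. \<bar>dec p j - dec q j\<bar> \<le> dist p q"
          using dist_bounded[of p _ q] by (auto simp: dec_def dist_real_def)
        then have "\<bar>F (dec p) (of_discrete k) - F (dec q) (of_discrete k)\<bar> \<le> L * dist p q"
          using lip True by simp
        also have "\<dots> \<le> max L 0 * dist p q"
          by (intro mult_right_mono) auto
        finally show ?thesis
          using True by (simp add: G_def enc_apply dist_real_def)
      qed (simp add: G_def enc_apply)
    qed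
    then show ?thesis by (simp add: dist_norm)
  qed
  then obtain p where p: "p 0 = enc a" "\<forall>t\<ge>0. (p has_vector_derivative G (p t)) (at t within {0..})"
    using lipschitz_ODE_solution_exists[of G _ "enc a"] by blast
  have eval: "bounded_linear (\<lambda>p :: 'i discrete \<Rightarrow>\<^sub>C real. apply_bcontfun p k)" for k
    by (rule bounded_linear_intro[where K = 1]) (auto simp: norm_bounded[where 'b = real, simplified])
  show ?thesis
  proof (intro exI[of _ "\<lambda>t. dec (p t)"] ballI conjI allI impI)
    fix i t assume i: "i \<in> I"
    show "dec (p 0) i = a i"
      using dec_enc[OF i] p(1) by simp
    assume "t \<ge> (0::real)"
    then have "((\<lambda>s. dec (p s) i) has_vector_derivative dec (G (p t)) i) (at t within {0..})"
      unfolding dec_def using p(2) by (intro bounded_linear.has_vector_derivative[OF eval]) auto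
    then show "((\<lambda>s. dec (p s) i) has_real_derivative F (dec (p t)) i) (at t within {0..})"
      by (simp add: G_def dec_enc[OF i] has_real_derivative_iff_has_vector_derivative)
  qed
qed

text \<open>
  Gronwall's argument for the sum of squares \<open>\<psi>\<close> of the differences. Each difference is at most
  \<open>sqrt \<psi>\<close>, so \<open>\<psi>' \<le> C \<psi>\<close>, and \<open>exp (- C t) \<psi>\<close> is nonincreasing, starts at \<open>0\<close>, and cannot be negative.
\<close>

theorem lipschitz_system_solution_unique:
  fixes F :: "('i \<Rightarrow> real) \<Rightarrow> 'i \<Rightarrow> real"
  assumes fin: "finite I"
    and lip: "\<And>a b \<epsilon> i. i \<in> I \<Longrightarrow> \<epsilon> \<ge> 0 \<Longrightarrow> \<forall>j\<in>I. \<bar>a j - b j\<bar> \<le> \<epsilon> \<Longrightarrow> \<bar>F a i - F b i\<bar> \<le> L * \<epsilon>"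
    and u: "\<And>i t. i \<in> I \<Longrightarrow> t \<ge> 0 \<Longrightarrow> ((\<lambda>s. u s i) has_real_derivative F (u t) i) (at t within {0..})"
    and v: "\<And>i t. i \<in> I \<Longrightarrow> t \<ge> 0 \<Longrightarrow> ((\<lambda>s. v s i) has_real_derivative F (v t) i) (at t within {0..})"
    and init: "\<And>i. i \<in> I \<Longrightarrow> u 0 i = v 0 i"
    and "i \<in> I" "t \<ge> 0"
  shows "u t i = v t i"
proof -
  define \<psi> where "\<psi> t = (\<Sum>i\<in>I. (u t i - v t i)\<^sup>2)" for t
  define \<psi>' where "\<psi>' t = (\<Sum>i\<in>I. 2 * (u t i - v t i) * (F (u t) i - F (v t) i))" for t
  define C where "C = 2 * real (card I) * L"
  have \<psi>_deriv: "(\<psi> has_real_derivative \<psi>' t) (at t within {0..})" if "t \<ge> 0" for t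
    unfolding \<psi>_def \<psi>'_def using u v that
    by (auto intro!: derivative_eq_intros sum.cong simp: algebra_simps)
  have growth: "\<psi>' t \<le> C * \<psi> t" for t
  proof -
    have dist: "\<bar>u t j - v t j\<bar> \<le> sqrt (\<psi> t)" if "j \<in> I" for j
      using member_le_sum[OF that, of "\<lambda>i. (u t i - v t i)\<^sup>2"] fin
      by (intro real_le_rsqrt) (auto simp: \<psi>_def)
    have \<psi>_nonneg: "\<psi> t \<ge> 0"
      by (simp add: \<psi>_def sum_nonneg)
    have "\<psi>' t \<le> (\<Sum>i\<in>I. 2 * sqrt (\<psi> t) * (L * sqrt (\<psi> t)))"
      unfolding \<psi>'_def
    proof (rule sum_mono)
      fix i assume i: "i \<in> I"
      have "\<bar>u t i - v t i\<bar> * \<bar>F (u t) i - F (v t) i\<bar> \<le> sqrt (\<psi> t) * (L * sqrt (\<psi> t))"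
        using dist lip[OF i, of "sqrt (\<psi> t)"] \<psi>_nonneg i by (intro mult_mono) auto
      then have "(u t i - v t i) * (F (u t) i - F (v t) i) \<le> sqrt (\<psi> t) * (L * sqrt (\<psi> t))"
        unfolding abs_mult[symmetric] by linarith
      then show "2 * (u t i - v t i) * (F (u t) i - F (v t) i) \<le> 2 * sqrt (\<psi> t) * (L * sqrt (\<psi> t))"
        unfolding mult.assoc by simp
    qed
    also have "\<dots> = C * (sqrt (\<psi> t) * sqrt (\<psi> t))"
      by (simp add: C_def mult_ac)
    finally show ?thesis
      using \<psi>_nonneg by simp
  qed
  have "exp (- C * t) * \<psi> t \<le> exp (- C * 0) * \<psi> 0"
  proof (rule DERIV_nonpos_imp_decreasing_open[where f = "\<lambda>t. exp (- C * t) * \<psi> t", OF \<open>t \<ge> 0\<close>])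
    fix s assume s: "0 < s" "s < t"
    have "(\<psi> has_real_derivative \<psi>' s) (at s)"
      using \<psi>_deriv[of s] s at_within_interior[of s "{0..}"] by (simp add: interior_real_atLeast)
    then have "((\<lambda>t. exp (- C * t) * \<psi> t) has_real_derivative exp (- C * s) * (\<psi>' s - C * \<psi> s)) (at s)"
      by (auto intro!: derivative_eq_intros simp: algebra_simps)
    moreover have "exp (- C * s) * (\<psi>' s - C * \<psi> s) \<le> 0"
      using growth[of s] by (simp add: mult_le_0_iff)
    ultimately show "\<exists>y. ((\<lambda>t. exp (- C * t) * \<psi> t) has_real_derivative y) (at s) \<and> y \<le> 0"
      by blast
  next
    have "continuous_on {0..} \<psi>"
      using \<psi>_deriv by (auto intro!: DERIV_continuous simp: continuous_on_eq_continuous_within)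
    then have "continuous_on {0..t} \<psi>"
      by (rule continuous_on_subset) auto
    then show "continuous_on {0..t} (\<lambda>t. exp (- C * t) * \<psi> t)"
      by (intro continuous_intros)
  qed
  also have "\<psi> 0 = 0"
    using init by (simp add: \<psi>_def)
  finally have "\<psi> t \<le> 0"
    by (simp add: mult_le_0_iff)
  moreover have "(u t i - v t i)\<^sup>2 \<le> \<psi> t"
    unfolding \<psi>_def using \<open>i \<in> I\<close> fin by (intro member_le_sum) auto
  ultimately have "(u t i - v t i)\<^sup>2 \<le> 0"
    by (rule order_trans[rotated])
  then show ?thesis by simp
qed


section \<open>The graph distance\<close>

lemma adj_relpow_sym: "(x, y) \<in> adj E ^^ n \<Longrightarrow> (y, x) \<in> adj E ^^ n"
proof (induction n arbitrary: y)
  case (Suc n)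
  then obtain z where "(x, z) \<in> adj E ^^ n" "(z, y) \<in> adj E"
    by auto
  then have "(z, x) \<in> adj E ^^ n" "(y, z) \<in> adj E"
    using Suc.IH by (auto simp: adj_def insert_commute)
  then show ?case
    by (rule relpow_Suc_I2[rotated])
qed simp

lemma graph_dist_commute: "graph_dist E x y = graph_dist E y x"
  unfolding graph_dist_def by (metis adj_relpow_sym)

lemma graph_dist_self [simp]: "graph_dist E x x = 0"
  by (simp add: graph_dist_def)

locale connected_graph =
  fixes V :: "'a set" and E :: "'a set set"
  assumes graph: "finite_connected_graph V E"
begin

lemma finite_V [simp]: "finite V"
  and edge_card: "e \<in> E \<Longrightarrow> card e = 2"
  and edge_subset: "e \<in> E \<Longrightarrow> e \<subseteq> V"
  using graph by (auto simp: finite_connected_graph_def)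

lemma finite_E [simp]: "finite E"
  using edge_subset by (intro finite_subset[of E "Pow V"]) auto

lemma edge_ends:
  assumes "{x, y} \<in> E" shows "x \<in> V" "y \<in> V" "x \<noteq> y"
  using edge_subset[OF assms] edge_card[OF assms] by auto

lemma graph_dist_walk:
  assumes "x \<in> V" "y \<in> V" shows "(x, y) \<in> adj E ^^ graph_dist E x y"
proof -
  have "(x, y) \<in> (adj E)\<^sup>*"
    using graph assms by (auto simp: finite_connected_graph_def)
  then obtain n where "(x, y) \<in> adj E ^^ n"
    by (auto simp: rtrancl_power)
  then show ?thesis
    unfolding graph_dist_def by (rule LeastI)
qed

lemma graph_dist_le: "(x, y) \<in> adj E ^^ n \<Longrightarrow> graph_dist E x y \<le> n"
  unfolding graph_dist_def by (rule Least_le)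

lemma graph_dist_triangle:
  assumes "x \<in> V" "y \<in> V" "z \<in> V"
  shows "graph_dist E x z \<le> graph_dist E x y + graph_dist E y z"
  using graph_dist_walk[of x y] graph_dist_walk[of y z] assms
  by (intro graph_dist_le) (auto simp: relpow_add)

lemma graph_dist_edge:
  assumes "{x, y} \<in> E" shows "graph_dist E x y = 1"
proof -
  have "graph_dist E x y \<le> 1"
    using assms by (intro graph_dist_le) (simp add: adj_def)
  moreover have "graph_dist E x y \<noteq> 0"
    using graph_dist_walk[of x y] edge_ends[OF assms] by (auto intro: gr0I)
  ultimately show ?thesis by linarith
qed

section \<open>Transport costs and convexity of the Wasserstein distance\<close>

definition transport_cost :: "('a \<Rightarrow> 'a \<Rightarrow> real) \<Rightarrow> real" where
  "transport_cost \<pi> = (\<Sum>u\<in>V. \<Sum>v\<in>V. real (graph_dist E u v) * \<pi> u v)"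

lemma wasserstein_le_cost:
  assumes "\<pi> \<in> couplings V \<mu> \<nu>"
  shows "wasserstein V E \<mu> \<nu> \<le> transport_cost \<pi>"
  unfolding wasserstein_def transport_cost_def
proof (rule cINF_lower[OF _ assms])
  show "bdd_below ((\<lambda>\<pi>. \<Sum>u\<in>V. \<Sum>v\<in>V. real (graph_dist E u v) * \<pi> u v) ` couplings V \<mu> \<nu>)"
    by (intro bdd_belowI2[where m = 0] sum_nonneg) (auto simp: couplings_def)
qed

lemma wasserstein_greatest:
  assumes "couplings V \<mu> \<nu> \<noteq> {}" "\<And>\<pi>. \<pi> \<in> couplings V \<mu> \<nu> \<Longrightarrow> c \<le> transport_cost \<pi>"
  shows "c \<le> wasserstein V E \<mu> \<nu>"
  using assms unfolding wasserstein_def transport_cost_def by (intro cINF_greatest)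

lemma wasserstein_commute:
  "wasserstein V E \<mu> \<nu> = wasserstein V E \<nu> \<mu>"
proof -
  have flip: "(\<lambda>u v. \<pi> v u) \<in> couplings V \<nu> \<mu>" if "\<pi> \<in> couplings V \<mu> \<nu>" for \<pi> :: "'a \<Rightarrow> 'a \<Rightarrow> real" and \<mu> \<nu>
    using that by (auto simp: couplings_def)
  have cost: "transport_cost (\<lambda>u v. \<pi> v u) = transport_cost \<pi>" for \<pi>
    unfolding transport_cost_def by (subst sum.swap) (simp add: graph_dist_commute)
  have "transport_cost ` couplings V \<mu> \<nu> = transport_cost ` couplings V \<nu> \<mu>"
    by (intro equalityI subsetI; elim imageE) (metis cost flip imageI)+
  then show ?thesis
    by (simp add: wasserstein_def transport_cost_def)
qed

text \<open>
  Both marginals of total mass \<open>1\<close> make the product a coupling, so that the infimum defining the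
  Wasserstein distance is taken over a nonempty set.
\<close>

definition prob_mass :: "('a \<Rightarrow> real) \<Rightarrow> bool" where
  "prob_mass \<mu> \<longleftrightarrow> (\<forall>u\<in>V. 0 \<le> \<mu> u) \<and> (\<Sum>u\<in>V. \<mu> u) = 1"

lemma product_coupling:
  assumes "prob_mass \<mu>" "prob_mass \<nu>"
  shows "(\<lambda>u v. \<mu> u * \<nu> v) \<in> couplings V \<mu> \<nu>"
  using assms
  by (auto simp: couplings_def prob_mass_def simp flip: sum_distrib_left sum_distrib_right)

text \<open>
  The cost of the product coupling is an average of distances between points of the two supports.
\<close>

lemma wasserstein_le_diameter:
  assumes "prob_mass \<mu>" "prob_mass \<nu>"
    and "\<And>u v. u \<in> V \<Longrightarrow> v \<in> V \<Longrightarrow> \<mu> u \<noteq> 0 \<Longrightarrow> \<nu> v \<noteq> 0 \<Longrightarrow> real (graph_dist E u v) \<le> c"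
  shows "wasserstein V E \<mu> \<nu> \<le> c"
proof -
  have "transport_cost (\<lambda>u v. \<mu> u * \<nu> v) \<le> (\<Sum>u\<in>V. \<Sum>v\<in>V. c * (\<mu> u * \<nu> v))"
    unfolding transport_cost_def
  proof (intro sum_mono)
    fix u v assume "u \<in> V" "v \<in> V"
    then show "real (graph_dist E u v) * (\<mu> u * \<nu> v) \<le> c * (\<mu> u * \<nu> v)"
      using assms(1,2) assms(3)[of u v]
      by (cases "\<mu> u = 0 \<or> \<nu> v = 0") (auto simp: prob_mass_def mult_right_mono simp del: mult_le_cancel_right)
  qed
  also have "\<dots> = c"
    using assms(1,2) by (simp add: prob_mass_def flip: sum_distrib_left sum_distrib_right)
  finally show ?thesis
    using wasserstein_le_cost[OF product_coupling[OF assms(1,2)]] by linarith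
qed

text \<open>
  The easy half of Kantorovich duality: integrate \<open>f u - f v\<close> against any coupling.
\<close>

lemma wasserstein_ge_dual:
  assumes "prob_mass \<mu>" "prob_mass \<nu>"
    and "\<And>u v. u \<in> V \<Longrightarrow> v \<in> V \<Longrightarrow> f u - f v \<le> real (graph_dist E u v)"
  shows "(\<Sum>u\<in>V. f u * \<mu> u) - (\<Sum>v\<in>V. f v * \<nu> v) \<le> wasserstein V E \<mu> \<nu>"
proof (rule wasserstein_greatest)
  show "couplings V \<mu> \<nu> \<noteq> {}"
    using product_coupling[OF assms(1,2)] by auto
  fix \<pi> assume \<pi>: "\<pi> \<in> couplings V \<mu> \<nu>"
  have "(\<Sum>u\<in>V. f u * \<mu> u) = (\<Sum>u\<in>V. \<Sum>v\<in>V. f u * \<pi> u v)"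
    using \<pi> by (simp add: couplings_def flip: sum_distrib_left)
  moreover have "(\<Sum>v\<in>V. f v * \<nu> v) = (\<Sum>u\<in>V. \<Sum>v\<in>V. f v * \<pi> u v)"
    using \<pi> by (subst sum.swap) (simp add: couplings_def flip: sum_distrib_left)
  ultimately have "(\<Sum>u\<in>V. f u * \<mu> u) - (\<Sum>v\<in>V. f v * \<nu> v) = (\<Sum>u\<in>V. \<Sum>v\<in>V. (f u - f v) * \<pi> u v)"
    by (simp add: sum_subtractf left_diff_distrib)
  also have "\<dots> \<le> transport_cost \<pi>"
    unfolding transport_cost_def using \<pi> assms(3)
    by (intro sum_mono mult_right_mono) (auto simp: couplings_def)
  finally show "(\<Sum>u\<in>V. f u * \<mu> u) - (\<Sum>v\<in>V. f v * \<nu> v) \<le> transport_cost \<pi>" .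
qed

definition mix :: "real \<Rightarrow> ('a \<Rightarrow> real) \<Rightarrow> ('a \<Rightarrow> real) \<Rightarrow> 'a \<Rightarrow> real" where
  "mix c \<mu> \<nu> u = c * \<mu> u + (1 - c) * \<nu> u"

lemma prob_mass_mix:
  assumes "0 \<le> c" "c \<le> 1" "prob_mass \<mu>" "prob_mass \<nu>"
  shows "prob_mass (mix c \<mu> \<nu>)"
  using assms by (auto simp: prob_mass_def mix_def sum.distrib simp flip: sum_distrib_left)

lemma wasserstein_approx:
  assumes "prob_mass \<mu>" "prob_mass \<nu>" "\<epsilon> > 0"
  obtains \<pi> where "\<pi> \<in> couplings V \<mu> \<nu>" "transport_cost \<pi> \<le> wasserstein V E \<mu> \<nu> + \<epsilon>"
proof (rule ccontr)
  assume "\<not> thesis"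
  then have "\<forall>\<pi>\<in>couplings V \<mu> \<nu>. wasserstein V E \<mu> \<nu> + \<epsilon> \<le> transport_cost \<pi>"
    using that by force
  then have "wasserstein V E \<mu> \<nu> + \<epsilon> \<le> wasserstein V E \<mu> \<nu>"
    using product_coupling[OF assms(1,2)] by (intro wasserstein_greatest) auto
  then show False using \<open>\<epsilon> > 0\<close> by simp
qed

text \<open>
  Mixing a nearly optimal coupling of each pair gives a coupling of the mixtures whose cost is the
  mixture of the costs.
\<close>

lemma wasserstein_convex:
  assumes c: "0 \<le> c" "c \<le> 1"
    and P: "prob_mass \<mu>1" "prob_mass \<mu>2" "prob_mass \<nu>1" "prob_mass \<nu>2"
  shows "wasserstein V E (mix c \<mu>1 \<mu>2) (mix c \<nu>1 \<nu>2)
    \<le> c * wasserstein V E \<mu>1 \<nu>1 + (1 - c) * wasserstein V E \<mu>2 \<nu>2"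
proof (rule field_le_epsilon)
  fix \<epsilon> :: real assume "\<epsilon> > 0"
  obtain \<pi>1 where 1: "\<pi>1 \<in> couplings V \<mu>1 \<nu>1" "transport_cost \<pi>1 \<le> wasserstein V E \<mu>1 \<nu>1 + \<epsilon>"
    using wasserstein_approx[OF P(1,3) \<open>\<epsilon> > 0\<close>] .
  obtain \<pi>2 where 2: "\<pi>2 \<in> couplings V \<mu>2 \<nu>2" "transport_cost \<pi>2 \<le> wasserstein V E \<mu>2 \<nu>2 + \<epsilon>"
    using wasserstein_approx[OF P(2,4) \<open>\<epsilon> > 0\<close>] .
  define \<pi> where "\<pi> u v = c * \<pi>1 u v + (1 - c) * \<pi>2 u v" for u v
  have "\<pi> \<in> couplings V (mix c \<mu>1 \<mu>2) (mix c \<nu>1 \<nu>2)"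
    using 1(1) 2(1) c
    by (auto simp: couplings_def mix_def \<pi>_def sum.distrib simp flip: sum_distrib_left)
  then have "wasserstein V E (mix c \<mu>1 \<mu>2) (mix c \<nu>1 \<nu>2) \<le> transport_cost \<pi>"
    by (rule wasserstein_le_cost)
  also have "transport_cost \<pi> = c * transport_cost \<pi>1 + (1 - c) * transport_cost \<pi>2"
    by (simp add: transport_cost_def \<pi>_def distrib_left sum.distrib sum_distrib_left mult_ac)
  also have "\<dots> \<le> c * (wasserstein V E \<mu>1 \<nu>1 + \<epsilon>) + (1 - c) * (wasserstein V E \<mu>2 \<nu>2 + \<epsilon>)"
    using 1(2) 2(2) c by (intro add_mono mult_left_mono) auto
  finally show "wasserstein V E (mix c \<mu>1 \<mu>2) (mix c \<nu>1 \<nu>2)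
    \<le> c * wasserstein V E \<mu>1 \<nu>1 + (1 - c) * wasserstein V E \<mu>2 \<nu>2 + \<epsilon>"
    by (simp add: algebra_simps)
qed

section \<open>The curvature as a monotone limit\<close>

definition point_mass :: "'a \<Rightarrow> 'a \<Rightarrow> real" where
  "point_mass x u = of_bool (u = x)"

lemma prob_mass_point: "x \<in> V \<Longrightarrow> prob_mass (point_mass x)"
  by (simp add: prob_mass_def point_mass_def of_bool_def)

text \<open>
  The step distributions at \<open>x\<close> are kept abstract, not tied to a weight: the remainder that appears
  when two weights are compared is a step distribution which need not come from the weights at hand.
\<close>

definition step_dist :: "'a \<Rightarrow> ('a \<Rightarrow> real) \<Rightarrow> bool" where
  "step_dist x r \<longleftrightarrow> prob_mass r \<and> (\<forall>u. {x, u} \<notin> E \<longrightarrow> r u = 0)"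

definition lazy :: "real \<Rightarrow> 'a \<Rightarrow> ('a \<Rightarrow> real) \<Rightarrow> 'a \<Rightarrow> real" where
  "lazy \<alpha> x r = mix \<alpha> (point_mass x) r"

definition curvature_quotient :: "'a \<Rightarrow> 'a \<Rightarrow> ('a \<Rightarrow> real) \<Rightarrow> ('a \<Rightarrow> real) \<Rightarrow> real \<Rightarrow> real" where
  "curvature_quotient x y r s \<alpha> = (1 - wasserstein V E (lazy \<alpha> x r) (lazy \<alpha> y s)) / (1 - \<alpha>)"

context
  fixes x y :: 'a
  assumes edge: "{x, y} \<in> E"
begin

lemma point_masses_distance: "wasserstein V E (point_mass x) (point_mass y) \<le> 1"
  using edge_ends[OF edge] graph_dist_edge[OF edge]
  by (intro wasserstein_le_diameter prob_mass_point) (auto simp: point_mass_def)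

text \<open>
  A neighbour of \<open>x\<close> and a neighbour of \<open>y\<close> are joined by a walk with three edges through \<open>x\<close> and \<open>y\<close>.
\<close>

lemma step_dists_distance:
  assumes "step_dist x r" "step_dist y s"
  shows "wasserstein V E r s \<le> 3"
proof (rule wasserstein_le_diameter)
  show "prob_mass r" "prob_mass s"
    using assms by (auto simp: step_dist_def)
  fix u v assume *: "u \<in> V" "v \<in> V" "r u \<noteq> 0" "s v \<noteq> 0"
  then have "{x, u} \<in> E" "{y, v} \<in> E"
    using assms by (auto simp: step_dist_def)
  then have "graph_dist E u x = 1" "graph_dist E y v = 1"
    using graph_dist_edge by (auto simp: graph_dist_commute[of E u])
  then show "real (graph_dist E u v) \<le> 3"
    using graph_dist_triangle[of u x v] graph_dist_triangle[of x y v] graph_dist_edge[OF edge]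
      edge_ends[OF edge] * by simp
qed

lemma prob_mass_lazy:
  assumes "0 \<le> \<alpha>" "\<alpha> \<le> 1" "step_dist z r" "z \<in> V"
  shows "prob_mass (lazy \<alpha> z r)"
  using assms unfolding lazy_def
  by (intro prob_mass_mix prob_mass_point) (auto simp: step_dist_def)

text \<open>
  Move the lazy parts across the edge and the rest along walks of length at most \<open>3\<close>:
  the transport distance is at most \<open>\<alpha> + 3 (1 - \<alpha>)\<close>.
\<close>

lemma curvature_quotient_ge:
  assumes "0 \<le> \<alpha>" "\<alpha> < 1" "step_dist x r" "step_dist y s"
  shows "curvature_quotient x y r s \<alpha> \<ge> -2"
proof -
  have "wasserstein V E (lazy \<alpha> x r) (lazy \<alpha> y s) \<le>
     \<alpha> * wasserstein V E (point_mass x) (point_mass y) + (1 - \<alpha>) * wasserstein V E r s"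
    unfolding lazy_def using assms edge_ends[OF edge]
    by (intro wasserstein_convex prob_mass_point) (auto simp: step_dist_def)
  also have "\<dots> \<le> \<alpha> * 1 + (1 - \<alpha>) * 3"
    using assms point_masses_distance step_dists_distance
    by (intro add_mono mult_left_mono) auto
  finally show ?thesis
    using assms by (simp add: curvature_quotient_def field_simps)
qed

text \<open>
  Test with the distance to \<open>y\<close>: it is \<open>1\<close> at \<open>x\<close>, \<open>0\<close> at \<open>y\<close> and \<open>1\<close> at every neighbour of \<open>y\<close>, so
  the transport distance is at least \<open>\<alpha> - (1 - \<alpha>)\<close>.
\<close>

lemma curvature_quotient_le:
  assumes "0 \<le> \<alpha>" "\<alpha> < 1" and r: "step_dist x r" and s: "step_dist y s"
  shows "curvature_quotient x y r s \<alpha> \<le> 2"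
proof -
  note [simp] = edge_ends[OF edge]
  define f where "f u = real (graph_dist E u y)" for u
  have sum_lazy: "(\<Sum>u\<in>V. f u * lazy \<alpha> z q u) = \<alpha> * f z + (1 - \<alpha>) * (\<Sum>u\<in>V. f u * q u)"
    if "z \<in> V" for z q
  proof -
    have "(\<Sum>u\<in>V. f u * point_mass z u) = f z"
      using that by (simp add: point_mass_def of_bool_def if_distrib cong: if_cong)
    then show ?thesis
      by (simp add: lazy_def mix_def distrib_left sum.distrib mult.left_commute[of "f _"]
          flip: sum_distrib_left)
  qed
  have "(\<Sum>u\<in>V. f u * lazy \<alpha> x r u) - (\<Sum>v\<in>V. f v * lazy \<alpha> y s v)
      \<le> wasserstein V E (lazy \<alpha> x r) (lazy \<alpha> y s)"
  proof (rule wasserstein_ge_dual)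
    show "f u - f v \<le> real (graph_dist E u v)" if "u \<in> V" "v \<in> V" for u v
      using graph_dist_triangle[of u v y] that by (simp add: f_def)
  qed (use assms in \<open>auto intro!: prob_mass_lazy\<close>)
  moreover have "(1 - \<alpha>) * (\<Sum>u\<in>V. f u * r u) \<ge> 0"
    using r assms(2)
    by (intro mult_nonneg_nonneg sum_nonneg) (auto simp: f_def step_dist_def prob_mass_def)
  moreover have "(\<Sum>v\<in>V. f v * s v) = (\<Sum>v\<in>V. s v)"
  proof (intro sum.cong refl)
    fix v show "f v * s v = s v"
      using s graph_dist_edge[of y v]
      by (cases "{y, v} \<in> E") (auto simp: f_def step_dist_def graph_dist_commute[of E v])
  qed
  moreover have "f x = 1" "f y = 0" "(\<Sum>v\<in>V. s v) = 1"
    using graph_dist_edge[OF edge] s by (auto simp: f_def step_dist_def prob_mass_def)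
  ultimately have "wasserstein V E (lazy \<alpha> x r) (lazy \<alpha> y s) \<ge> \<alpha> - (1 - \<alpha>)"
    using sum_lazy[of x r] sum_lazy[of y s] by simp
  then show ?thesis
    using assms by (simp add: curvature_quotient_def field_simps)
qed

text \<open>
  A lazier walk is a mixture of a less lazy one with the starting point, so convexity compares the
  two distances. The point masses contribute \<open>1 - W = 0\<close>.
\<close>

lemma curvature_quotient_mono:
  assumes "0 \<le> \<alpha>" "\<alpha> \<le> \<beta>" "\<beta> < 1" "step_dist x r" "step_dist y s"
  shows "curvature_quotient x y r s \<alpha> \<le> curvature_quotient x y r s \<beta>"
proof -
  define c where "c = (1 - \<beta>) / (1 - \<alpha>)"
  have c: "0 \<le> c" "c \<le> 1" and c_mult: "c * (1 - \<alpha>) = 1 - \<beta>"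
    using assms by (auto simp: c_def)
  have split: "lazy \<beta> z q = mix c (lazy \<alpha> z q) (point_mass z)" for z q
  proof
    fix u
    have "c * \<alpha> = c - (1 - \<beta>)"
      using c_mult by (simp add: algebra_simps)
    moreover have "mix c (lazy \<alpha> z q) (point_mass z) u
        = (c * \<alpha> + (1 - c)) * point_mass z u + c * (1 - \<alpha>) * q u"
      by (simp add: lazy_def mix_def algebra_simps)
    ultimately show "lazy \<beta> z q u = mix c (lazy \<alpha> z q) (point_mass z) u"
      by (simp add: c_mult lazy_def mix_def)
  qed
  have "wasserstein V E (lazy \<beta> x r) (lazy \<beta> y s)
     \<le> c * wasserstein V E (lazy \<alpha> x r) (lazy \<alpha> y s)
       + (1 - c) * wasserstein V E (point_mass x) (point_mass y)"
    unfolding split[of x] split[of y] using assms c edge_ends[OF edge]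
    by (intro wasserstein_convex prob_mass_lazy prob_mass_point) auto
  also have "\<dots> \<le> c * wasserstein V E (lazy \<alpha> x r) (lazy \<alpha> y s) + (1 - c) * 1"
    using c point_masses_distance by (intro add_left_mono mult_left_mono) auto
  finally have "c * (1 - wasserstein V E (lazy \<alpha> x r) (lazy \<alpha> y s))
      \<le> 1 - wasserstein V E (lazy \<beta> x r) (lazy \<beta> y s)"
    by (simp add: algebra_simps)
  then show ?thesis
    using assms by (simp add: curvature_quotient_def c_def field_simps)
qed

text \<open>
  Replacing a fraction \<open>1 - c\<close> of both step distributions costs at most \<open>4 (1 - c)\<close>. By convexity the
  quotient of the mixture is at least the mixture of the quotients, and any two quotients differ by
  at most \<open>4\<close> because they lie in \<open>[- 2, 2]\<close>. The bound is uniform in the laziness \<open>\<alpha>\<close>.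
\<close>

lemma curvature_quotient_mix:
  assumes \<alpha>: "0 \<le> \<alpha>" "\<alpha> < 1" and c: "0 \<le> c" "c \<le> 1"
    and r: "step_dist x r" "step_dist x r'" and s: "step_dist y s" "step_dist y s'"
  shows "curvature_quotient x y r s \<alpha> - 4 * (1 - c)
    \<le> curvature_quotient x y (mix c r r') (mix c s s') \<alpha>"
proof -
  have split: "lazy \<alpha> z (mix c q q') = mix c (lazy \<alpha> z q) (lazy \<alpha> z q')" for z q q'
    by (auto simp: lazy_def mix_def algebra_simps)
  let ?W = "wasserstein V E (lazy \<alpha> x r) (lazy \<alpha> y s)"
  let ?W' = "wasserstein V E (lazy \<alpha> x r') (lazy \<alpha> y s')"
  let ?Wm = "wasserstein V E (lazy \<alpha> x (mix c r r')) (lazy \<alpha> y (mix c s s'))"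
  have "?Wm \<le> c * ?W + (1 - c) * ?W'"
    unfolding split using \<alpha> c r s edge_ends[OF edge]
    by (intro wasserstein_convex prob_mass_lazy) auto
  then have "c * (1 - ?W) + (1 - c) * (1 - ?W') \<le> 1 - ?Wm"
    by (simp add: algebra_simps)
  then have "(c * (1 - ?W) + (1 - c) * (1 - ?W')) / (1 - \<alpha>) \<le> (1 - ?Wm) / (1 - \<alpha>)"
    using \<alpha> by (intro divide_right_mono) auto
  then have "c * curvature_quotient x y r s \<alpha> + (1 - c) * curvature_quotient x y r' s' \<alpha>
    \<le> curvature_quotient x y (mix c r r') (mix c s s') \<alpha>"
    by (simp add: curvature_quotient_def add_divide_distrib)
  moreover have "(1 - c) * (-2) \<le> (1 - c) * curvature_quotient x y r' s' \<alpha>"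
    using c curvature_quotient_ge[OF \<alpha> r(2) s(2)] by (intro mult_left_mono) auto
  moreover have "(1 - c) * curvature_quotient x y r s \<alpha> \<le> (1 - c) * 2"
    using c curvature_quotient_le[OF \<alpha> r(1) s(1)] by (intro mult_left_mono) auto
  ultimately show ?thesis
    by (simp add: algebra_simps)
qed

text \<open>
  Monotone and bounded, the quotient converges; this justifies the \<open>Lim\<close> in the definition of
  the curvature.
\<close>

lemma curvature_quotient_convergent:
  assumes r: "step_dist x r" and s: "step_dist y s"
  shows "\<exists>k. (curvature_quotient x y r s \<longlongrightarrow> k) (at_left 1)"
proof -
  let ?q = "curvature_quotient x y r s"
  have bdd: "bdd_above (?q ` {0..<1})"
    using curvature_quotient_le[OF _ _ r s] by (intro bdd_aboveI2[where M = 2]) auto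
  have ev: "eventually (\<lambda>\<alpha>. \<alpha> \<in> {a..<1}) (at_left (1::real))" if "a < 1" for a :: real
    using eventually_at_left_real[OF that] by eventually_elim auto
  have "(?q \<longlongrightarrow> Sup (?q ` {0..<1})) (at_left 1)"
  proof (rule increasing_tendsto)
    show "\<forall>\<^sub>F \<alpha> in at_left 1. ?q \<alpha> \<le> Sup (?q ` {0..<1})"
      using ev[of 0] by (auto elim!: eventually_mono intro!: cSUP_upper bdd)
    fix l assume "l < Sup (?q ` {0..<1})"
    then obtain a where a: "a \<in> {0..<1}" "l < ?q a"
      by (subst (asm) less_cSUP_iff) (auto simp: bdd)
    show "\<forall>\<^sub>F \<alpha> in at_left 1. l < ?q \<alpha>"
      using ev[of a] a
      by (auto elim!: eventually_mono intro: less_le_trans curvature_quotient_mono[OF _ _ _ r s])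
  qed
  then show ?thesis ..
qed

end

section \<open>Curvature is Lipschitz in the logarithms of the weights\<close>

definition step_prob :: "('a set \<Rightarrow> real) \<Rightarrow> 'a \<Rightarrow> 'a \<Rightarrow> real" where
  "step_prob \<omega> x u = (if {x, u} \<in> E then \<omega> {x, u} / vertex_weight E \<omega> x else 0)"

lemma neighbours_in_V: "finite {u. {x, u} \<in> E}" "{u. {x, u} \<in> E} \<subseteq> V"
proof -
  show *: "{u. {x, u} \<in> E} \<subseteq> V"
    using edge_ends by auto
  show "finite {u. {x, u} \<in> E}"
    using finite_subset[OF * finite_V] .
qed

lemma vertex_weight_pos:
  assumes "\<forall>e\<in>E. \<omega> e > 0" "{x, y} \<in> E"
  shows "vertex_weight E \<omega> x > 0"
  unfolding vertex_weight_def using assms neighbours_in_V by (intro sum_pos) auto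

lemma step_dist_step_prob:
  assumes pos: "\<forall>e\<in>E. \<omega> e > 0" and edge: "{x, y} \<in> E"
  shows "step_dist x (step_prob \<omega> x)"
proof -
  have "(\<Sum>u\<in>V. step_prob \<omega> x u) = (\<Sum>u | {x, u} \<in> E. \<omega> {x, u} / vertex_weight E \<omega> x)"
    unfolding step_prob_def using neighbours_in_V by (intro sum.mono_neutral_cong_right) auto
  also have "\<dots> = 1"
    using vertex_weight_pos[OF pos edge]
    by (simp add: vertex_weight_def flip: sum_divide_distrib)
  finally show ?thesis
    using pos vertex_weight_pos[OF pos edge]
    by (auto simp: step_dist_def prob_mass_def step_prob_def intro!: divide_nonneg_pos less_imp_le)
qed

lemma lazy_walk_eq: 
  assumes "{x, y} \<in> E"
  shows "lazy_walk E \<omega> \<alpha> x = lazy \<alpha> x (step_prob \<omega> x)"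
  using edge_ends(3)[of x x]
  by (auto simp: fun_eq_iff lazy_walk_def lazy_def mix_def point_mass_def step_prob_def)

lemma lly_curvature_limit:
  assumes pos: "\<forall>e\<in>E. \<omega> e > 0" and edge: "{x, y} \<in> E"
  shows "(curvature_quotient x y (step_prob \<omega> x) (step_prob \<omega> y) \<longlongrightarrow> lly_curvature V E \<omega> x y) (at_left 1)"
proof -
  have edge': "{y, x} \<in> E"
    using edge by (simp add: insert_commute)
  obtain k where k: "(curvature_quotient x y (step_prob \<omega> x) (step_prob \<omega> y) \<longlongrightarrow> k) (at_left 1)"
    using curvature_quotient_convergent[OF edge step_dist_step_prob[OF pos edge] step_dist_step_prob[OF pos edge']]
    by blast
  have "lly_curvature V E \<omega> x y = Lim (at_left 1) (curvature_quotient x y (step_prob \<omega> x) (step_prob \<omega> y))"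
    by (simp add: lly_curvature_def curvature_quotient_def[abs_def] graph_dist_edge[OF edge]
        lazy_walk_eq[OF edge] lazy_walk_eq[OF edge'])
  also have "\<dots> = k"
    using k by (intro tendsto_Lim) auto
  finally show ?thesis
    using k by simp
qed

lemma lly_curvature_cong:
  assumes "\<And>e. e \<in> E \<Longrightarrow> \<omega> e = \<omega>' e"
  shows "lly_curvature V E \<omega> x y = lly_curvature V E \<omega>' x y"
proof -
  have "vertex_weight E \<omega> z = vertex_weight E \<omega>' z" for z
    unfolding vertex_weight_def using assms by (intro sum.cong) auto
  then have "lazy_walk E \<omega> \<alpha> z = lazy_walk E \<omega>' \<alpha> z" for \<alpha> z
    using assms by (auto simp: lazy_walk_def fun_eq_iff)
  then show ?thesis
    by (simp add: lly_curvature_def)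
qed

lemma lly_curvature_commute: "lly_curvature V E \<omega> x y = lly_curvature V E \<omega> y x"
  by (simp add: lly_curvature_def wasserstein_commute graph_dist_commute)

text \<open>
  If the two weights agree up to a factor \<open>exp \<epsilon>\<close>, then so do their vertex weights, hence the
  transition probabilities agree up to \<open>exp (2 \<epsilon>)\<close>. Thus \<open>exp (- 2 \<epsilon>)\<close> times the old step
  distribution lies below the new one, and what is left over is a step distribution after
  normalization.
\<close>

lemma step_prob_mix:
  assumes pos: "\<forall>e\<in>E. \<omega> e > 0" "\<forall>e\<in>E. \<omega>' e > 0" and edge: "{x, y} \<in> E" and "\<epsilon> > 0"
    and le: "\<forall>e\<in>E. \<omega> e \<le> exp \<epsilon> * \<omega>' e" "\<forall>e\<in>E. \<omega>' e \<le> exp \<epsilon> * \<omega> e"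
  obtains r where "step_dist x r" "step_prob \<omega>' x = mix (exp (- (2 * \<epsilon>))) (step_prob \<omega> x) r"
proof
  define c where "c = exp (- (2 * \<epsilon>))"
  have c: "0 < c" "c < 1"
    using \<open>\<epsilon> > 0\<close> by (auto simp: c_def)
  define r where "r u = (step_prob \<omega>' x u - c * step_prob \<omega> x u) / (1 - c)" for u
  show "step_prob \<omega>' x = mix (exp (- (2 * \<epsilon>))) (step_prob \<omega> x) r"
    unfolding c_def[symmetric] using c by (auto simp: mix_def r_def)
  have dist: "step_dist x (step_prob \<omega> x)" "step_dist x (step_prob \<omega>' x)"
    using step_dist_step_prob[OF _ edge] pos by auto
  have m_pos: "vertex_weight E \<omega> x > 0" "vertex_weight E \<omega>' x > 0"
    using vertex_weight_pos[OF _ edge] pos by auto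
  have m_le: "vertex_weight E \<omega>' x \<le> exp \<epsilon> * vertex_weight E \<omega> x"
    unfolding vertex_weight_def sum_distrib_left using le by (intro sum_mono) auto
  have ge: "c * step_prob \<omega> x u \<le> step_prob \<omega>' x u" for u
  proof (cases "{x, u} \<in> E")
    case True
    have "\<omega> {x, u} * vertex_weight E \<omega>' x \<le> (exp \<epsilon> * \<omega>' {x, u}) * (exp \<epsilon> * vertex_weight E \<omega> x)"
      using True le pos m_pos m_le by (intro mult_mono) (auto intro: less_imp_le)
    also have "\<dots> = (\<omega>' {x, u} * vertex_weight E \<omega> x) / c"
      by (simp add: c_def exp_minus field_simps flip: exp_add)
    finally show ?thesis
      using True m_pos c by (simp add: step_prob_def field_simps)
  qed (simp add: step_prob_def)
  have "(\<Sum>u\<in>V. r u) = ((\<Sum>u\<in>V. step_prob \<omega>' x u) - c * (\<Sum>u\<in>V. step_prob \<omega> x u)) / (1 - c)"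
    by (simp add: r_def sum_subtractf sum_distrib_left flip: sum_divide_distrib)
  also have "\<dots> = 1"
    using dist c by (simp add: step_dist_def prob_mass_def)
  finally show "step_dist x r"
    using ge c dist by (auto simp: step_dist_def prob_mass_def r_def)
qed

text \<open>
  The mixing estimate with \<open>1 - exp (- 2 \<epsilon>) \<le> 2 \<epsilon>\<close>, passed to the limit \<open>\<alpha> \<rightarrow> 1\<close>: its constants
  do not depend on \<open>\<alpha>\<close>.
\<close>

lemma lly_curvature_log_lower:
  assumes pos: "\<forall>e\<in>E. \<omega> e > 0" "\<forall>e\<in>E. \<omega>' e > 0" and edge: "{x, y} \<in> E" and "\<epsilon> > 0"
    and le: "\<forall>e\<in>E. \<omega> e \<le> exp \<epsilon> * \<omega>' e" "\<forall>e\<in>E. \<omega>' e \<le> exp \<epsilon> * \<omega> e"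
  shows "lly_curvature V E \<omega> x y - 8 * \<epsilon> \<le> lly_curvature V E \<omega>' x y"
proof -
  have edge': "{y, x} \<in> E"
    using edge by (simp add: insert_commute)
  define c where "c = exp (- (2 * \<epsilon>))"
  have c: "0 \<le> c" "c \<le> 1" "1 - c \<le> 2 * \<epsilon>"
    using \<open>\<epsilon> > 0\<close> exp_ge_add_one_self[of "- (2 * \<epsilon>)"] by (auto simp: c_def)
  obtain r where r: "step_dist x r" "step_prob \<omega>' x = mix c (step_prob \<omega> x) r"
    using step_prob_mix[OF pos edge \<open>\<epsilon> > 0\<close> le] unfolding c_def .
  obtain s where s: "step_dist y s" "step_prob \<omega>' y = mix c (step_prob \<omega> y) s"
    using step_prob_mix[OF pos edge' \<open>\<epsilon> > 0\<close> le] unfolding c_def .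
  have "curvature_quotient x y (step_prob \<omega> x) (step_prob \<omega> y) \<alpha> - 8 * \<epsilon>
      \<le> curvature_quotient x y (step_prob \<omega>' x) (step_prob \<omega>' y) \<alpha>" if "\<alpha> \<in> {0<..<1}" for \<alpha>
    using curvature_quotient_mix[OF edge _ _ c(1,2) _ r(1) _ s(1), of \<alpha> "step_prob \<omega> x" "step_prob \<omega> y"]
      that c(3) step_dist_step_prob[OF pos(1) edge] step_dist_step_prob[OF pos(1) edge']
    by (simp add: r(2) s(2))
  moreover have "\<forall>\<^sub>F \<alpha> in at_left 1. \<alpha> \<in> {0<..<1::real}"
    by (rule eventually_at_left_real) simp
  ultimately have "\<forall>\<^sub>F \<alpha> in at_left 1. curvature_quotient x y (step_prob \<omega> x) (step_prob \<omega> y) \<alpha> - 8 * \<epsilon>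
      \<le> curvature_quotient x y (step_prob \<omega>' x) (step_prob \<omega>' y) \<alpha>"
    by (auto elim!: eventually_mono)
  then show ?thesis
    by (intro tendsto_le[OF _ lly_curvature_limit[OF pos(2) edge]
          tendsto_diff[OF lly_curvature_limit[OF pos(1) edge] tendsto_const]]) auto
qed

text \<open>
  The point of logarithmic coordinates: weights whose logarithms differ by at most \<open>\<epsilon>\<close> satisfy
  the hypotheses of the one-sided estimate in both directions. The case \<open>\<epsilon> = 0\<close>, where the
  remainder distribution would have mass \<open>0\<close>, is reached by letting a margin \<open>\<delta>\<close> tend to \<open>0\<close>.
\<close>

theorem lly_curvature_log_lipschitz:
  assumes edge: "{x, y} \<in> E" and "\<epsilon> \<ge> 0" and close: "\<forall>e\<in>E. \<bar>u e - v e\<bar> \<le> \<epsilon>"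
  shows "\<bar>lly_curvature V E (\<lambda>e. exp (u e)) x y - lly_curvature V E (\<lambda>e. exp (v e)) x y\<bar> \<le> 8 * \<epsilon>"
proof (rule field_le_epsilon)
  fix \<delta> :: real assume "\<delta> > 0"
  have "\<forall>e\<in>E. exp (u e) \<le> exp (\<epsilon> + \<delta> / 8) * exp (v e)" "\<forall>e\<in>E. exp (v e) \<le> exp (\<epsilon> + \<delta> / 8) * exp (u e)"
    using close \<open>\<delta> > 0\<close> by (auto simp: abs_le_iff simp flip: exp_add dest!: bspec)
  then show "\<bar>lly_curvature V E (\<lambda>e. exp (u e)) x y - lly_curvature V E (\<lambda>e. exp (v e)) x y\<bar> \<le> 8 * \<epsilon> + \<delta>"
    using lly_curvature_log_lower[of "\<lambda>e. exp (u e)" "\<lambda>e. exp (v e)" x y "\<epsilon> + \<delta> / 8"]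
      lly_curvature_log_lower[of "\<lambda>e. exp (v e)" "\<lambda>e. exp (u e)" x y "\<epsilon> + \<delta> / 8"]
      edge \<open>\<epsilon> \<ge> 0\<close> \<open>\<delta> > 0\<close> by (auto simp: abs_le_iff)
qed

text \<open>
  The curvature as a function of the unordered edge, which makes the flow a system indexed by \<open>E\<close>;
  the choice of the order of the ends is immaterial by symmetry.
\<close>

definition edge_curvature :: "('a set \<Rightarrow> real) \<Rightarrow> 'a set \<Rightarrow> real" where
  "edge_curvature \<omega> e = (SOME k. \<exists>x y. e = {x, y} \<and> k = lly_curvature V E \<omega> x y)"

lemma edge_curvature_eq: "edge_curvature \<omega> {x, y} = lly_curvature V E \<omega> x y"
  unfolding edge_curvature_def
  by (rule some_equality) (auto simp: doubleton_eq_iff lly_curvature_commute)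

lemma edge_obtain_ends:
  assumes "e \<in> E" obtains x y where "e = {x, y}"
  using edge_card[OF assms] by (auto simp: card_2_iff)

text \<open>
  The flow in the coordinates \<open>u = ln \<omega>\<close>: since \<open>\<omega>' / \<omega> = u'\<close>, the factor \<open>\<omega>\<close> on the right-hand side
  disappears and positivity of \<open>\<omega>\<close> is no longer a constraint.
\<close>

definition log_field :: "('a set \<Rightarrow> real) \<Rightarrow> ('a set \<Rightarrow> real) \<Rightarrow> 'a set \<Rightarrow> real" where
  "log_field \<kappa>' u e = \<kappa>' e - edge_curvature (\<lambda>e. exp (u e)) e"

lemma log_field_lipschitz:
  assumes "e \<in> E" "\<epsilon> \<ge> 0" "\<forall>j\<in>E. \<bar>u j - v j\<bar> \<le> \<epsilon>"
  shows "\<bar>log_field \<kappa>' u e - log_field \<kappa>' v e\<bar> \<le> 8 * \<epsilon>"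
proof -
  obtain x y where e: "e = {x, y}"
    using edge_obtain_ends[OF assms(1)] .
  then show ?thesis
    using lly_curvature_log_lipschitz[OF _ assms(2,3), of x y] assms(1)
    by (simp add: log_field_def edge_curvature_eq)
qed

lemma exp_log_solution:
  assumes u: "\<And>e t. e \<in> E \<Longrightarrow> t \<ge> 0 \<Longrightarrow>
      ((\<lambda>s. u s e) has_real_derivative log_field \<kappa>' (u t) e) (at t within {0..})"
    and init: "\<And>e. e \<in> E \<Longrightarrow> exp (u 0 e) = \<omega>0 e"
  shows "positive_flow_solution V E \<kappa>' \<omega>0 (\<lambda>t e. exp (u t e))"
  unfolding positive_flow_solution_def
proof (intro conjI allI impI ballI)
  fix t x y assume "0 \<le> (t::real)" "{x, y} \<in> E"
  then show "((\<lambda>s. exp (u s {x, y})) has_real_derivative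
      - (lly_curvature V E (\<lambda>e. exp (u t e)) x y - \<kappa>' {x, y}) * exp (u t {x, y})) (at t within {0..})"
    using u[of "{x, y}" t]
    by (auto intro!: derivative_eq_intros simp: log_field_def edge_curvature_eq)
qed (use init in auto)

lemma ln_solution:
  assumes sol: "positive_flow_solution V E \<kappa>' \<omega>0 \<omega>" and "e \<in> E" "t \<ge> 0"
  shows "((\<lambda>s. ln (\<omega> s e)) has_real_derivative log_field \<kappa>' (\<lambda>e. ln (\<omega> t e)) e) (at t within {0..})"
proof -
  obtain x y where e: "e = {x, y}"
    using edge_obtain_ends[OF \<open>e \<in> E\<close>] .
  have pos: "\<omega> t j > 0" if "j \<in> E" for j
    using sol that \<open>t \<ge> 0\<close> by (simp add: positive_flow_solution_def)
  have "lly_curvature V E (\<lambda>e. exp (ln (\<omega> t e))) x y = lly_curvature V E (\<omega> t) x y"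
    using pos by (intro lly_curvature_cong) auto
  then have field: "log_field \<kappa>' (\<lambda>e. ln (\<omega> t e)) e = - (lly_curvature V E (\<omega> t) x y - \<kappa>' e)"
    by (simp add: log_field_def e edge_curvature_eq)
  have "((\<lambda>s. \<omega> s e) has_real_derivative - (lly_curvature V E (\<omega> t) x y - \<kappa>' e) * \<omega> t e) (at t within {0..})"
    using sol assms(2,3) by (simp add: positive_flow_solution_def e)
  then show ?thesis
    unfolding field using pos[OF \<open>e \<in> E\<close>]
    by (auto intro!: derivative_eq_intros simp: field_simps)
qed

end

section \<open>Existence and uniqueness of the flow\<close>

theorem theorem2p1:
  fixes V :: "'a set" and E :: "'a set set"
    and \<kappa>' :: "'a set \<Rightarrow> real" and \<omega>0 :: "'a set \<Rightarrow> real"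
  assumes "finite_connected_graph V E"
    and "\<forall>e\<in>E. \<omega>0 e > 0"
  shows "\<exists>\<omega>. positive_flow_solution V E \<kappa>' \<omega>0 \<omega> \<and>
           (\<forall>\<omega>'. positive_flow_solution V E \<kappa>' \<omega>0 \<omega>' \<longrightarrow> (\<forall>t\<ge>0. \<forall>e\<in>E. \<omega>' t e = \<omega> t e))"
proof -
  interpret connected_graph V E
    by unfold_locales (rule assms(1))
  obtain u where u: "\<forall>e\<in>E. u 0 e = ln (\<omega>0 e) \<and>
      (\<forall>t\<ge>0. ((\<lambda>s. u s e) has_real_derivative log_field \<kappa>' (u t) e) (at t within {0..}))"
    using lipschitz_system_solution_exists[where F = "log_field \<kappa>'" and a = "\<lambda>e. ln (\<omega>0 e)", OF finite_E]
      log_field_lipschitz by blast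
  have sol: "positive_flow_solution V E \<kappa>' \<omega>0 (\<lambda>t e. exp (u t e))"
    using u assms(2) by (intro exp_log_solution) auto
  have "\<omega>' t e = exp (u t e)"
    if \<omega>': "positive_flow_solution V E \<kappa>' \<omega>0 \<omega>'" and "t \<ge> 0" "e \<in> E" for \<omega>' t e
  proof -
    have "ln (\<omega>' t e) = u t e"
    proof (rule lipschitz_system_solution_unique[OF finite_E log_field_lipschitz, where v = u])
      show "ln (\<omega>' 0 e) = u 0 e" if "e \<in> E" for e
        using u \<omega>' that by (simp add: positive_flow_solution_def)
    qed (use ln_solution[OF \<omega>'] u that in auto)
    moreover have "\<omega>' t e > 0"
      using that by (simp add: positive_flow_solution_def)
    ultimately show ?thesis
      by (metis exp_ln)
  qed
  with sol show ?thesis by blast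
qed

end
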